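(* Any deterministic algorithm for the MST problem under explorable uncertainty with predictions has competitive ratio $\rho\ge\min\left\{1+\frac{k_h}{|\mathrm{OPT}|},2\right\}$; this holds even when restricted to instances whose graph consists of edge-disjoint cycles that are prediction mandatory free.
   Context: MST problem under explorable uncertainty with predictions: an instance is a connected (multi)graph $G=(V,E)$; each edge $e$ has an unknown true weight $w_e\in\mathbb{R}_+$ and a known uncertainty interval $I_e$, either an open interval $(L_e,U_e)\ni w_e$ or trivial $\{w_e\}$ (then $L_e=U_e=w_e$). Querying $e$ reveals $w_e$. $Q\subseteq E$ is a feasible query set if some spanning tree is a minimum spanning tree for every weight assignment equal to $w_e$ on $Q$ and arbitrary in $I_e$ outside $Q$; $\mathrm{OPT}$ is a minimum-cardinality feasible query set. The algorithm queries adaptively (adversarial true values) until its query set $\mathrm{ALG}$ is feasible, and receives predictions $\hat w_e\in I_e$. Hop distance: for distinct $e,e'$, $k_{e'}(e)=0$ if $w_e$ and $\hat w_e$ lie in the same one of the regions $(-\infty,L_{e'}]$, $(L_{e'},U_{e'})$, $[U_{e'},\infty)$, else $k_{e'}(e)=1$; $k_h=\sum_{e}\sum_{e'\ne e}k_{e'}(e)$. An edge is prediction mandatory if it belongs to every feasible query set under the hypothesis that all true values equal the predicted values; an instance is prediction mandatory free if it has no prediction mandatory edge. *)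

theory Defs
  imports "HOL-Library.Extended_Real"
begin

record ('v, 'e) multigraph =
  verts :: "'v set"
  edges :: "'e set"
  ends :: "'e \<Rightarrow> 'v set"

text \<open>Parallel edges are allowed. Loops are not: they never belong to a spanning tree.\<close>

definition multigraph :: "('v, 'e, 'z) multigraph_scheme \<Rightarrow> bool" where
  "multigraph G \<longleftrightarrow> finite (verts G) \<and> verts G \<noteq> {} \<and> finite (edges G) \<and>
     (\<forall>e\<in>edges G. ends G e \<subseteq> verts G \<and> card (ends G e) = 2)"

definition connects :: "('v, 'e, 'z) multigraph_scheme \<Rightarrow> 'e set \<Rightarrow> bool" where
  "connects G F \<longleftrightarrow>
     (\<forall>u\<in>verts G. \<forall>v\<in>verts G. (u, v) \<in> {(x, y). \<exists>e\<in>F. ends G e = {x, y}}\<^sup>*)"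

text \<open>Two parallel edges form a cycle of length 2.\<close>

definition is_cycle :: "('v, 'e, 'z) multigraph_scheme \<Rightarrow> 'e set \<Rightarrow> bool" where
  "is_cycle G C \<longleftrightarrow> (\<exists>vs es. length es = length vs \<and> 2 \<le> length vs \<and>
     distinct vs \<and> distinct es \<and> set vs \<subseteq> verts G \<and> set es \<subseteq> edges G \<and>
     (\<forall>i<length vs. ends G (es ! i) = {vs ! i, vs ! (Suc i mod length vs)}) \<and>
     C = set es)"

definition spanning_tree :: "('v, 'e, 'z) multigraph_scheme \<Rightarrow> 'e set \<Rightarrow> bool" where
  "spanning_tree G T \<longleftrightarrow>
     T \<subseteq> edges G \<and> connects G T \<and> \<not> (\<exists>C\<subseteq>T. is_cycle G C)"

definition is_MST :: "('v, 'e, 'z) multigraph_scheme \<Rightarrow> ('e \<Rightarrow> real) \<Rightarrow> 'e set \<Rightarrow> bool" where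
  "is_MST G w T \<longleftrightarrow>
     spanning_tree G T \<and> (\<forall>T'. spanning_tree G T' \<longrightarrow> sum w T \<le> sum w T')"

text \<open>The graph consists of edge-disjoint cycles: distinct cycles of the graph share no edge,
  and every edge lies on a cycle.\<close>

definition edge_disjoint_cycles :: "('v, 'e, 'z) multigraph_scheme \<Rightarrow> bool" where
  "edge_disjoint_cycles G \<longleftrightarrow>
     (\<forall>C D. is_cycle G C \<longrightarrow> is_cycle G D \<longrightarrow> C \<noteq> D \<longrightarrow> C \<inter> D = {}) \<and>
     \<Union>{C. is_cycle G C} = edges G"

text \<open>The information available to an algorithm before the first query. The true weights
  are kept separate, as a function \<open>w\<close> of which only the values on the edges matter.\<close>

record ('v, 'e) uncertain_graph = "('v, 'e) multigraph" +
  lower :: "'e \<Rightarrow> real"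
  upper :: "'e \<Rightarrow> real"
  prediction :: "'e \<Rightarrow> real"

definition uncertainty_interval :: "('v, 'e) uncertain_graph \<Rightarrow> 'e \<Rightarrow> real set" where
  "uncertainty_interval P e =
     (if lower P e = upper P e then {lower P e} else {lower P e<..<upper P e})"

text \<open>Weights are nonnegative, hence so are the endpoints of the uncertainty intervals.
  An inverted interval (\<open>upper P e < lower P e\<close>) is empty and thus excluded by \<open>w e\<close>
  belonging to it.\<close>

definition mst_instances :: "(('v, 'e) uncertain_graph \<times> ('e \<Rightarrow> real)) set" where
  "mst_instances = {(P, w). multigraph P \<and> connects P (edges P) \<and>
     (\<forall>e\<in>edges P. 0 \<le> lower P e \<and>
        w e \<in> uncertainty_interval P e \<and> prediction P e \<in> uncertainty_interval P e)}"

definition feasible :: "('v, 'e) uncertain_graph \<Rightarrow> ('e \<Rightarrow> real) \<Rightarrow> 'e set \<Rightarrow> bool" where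
  "feasible P w Q \<longleftrightarrow> Q \<subseteq> edges P \<and>
     (\<exists>T. spanning_tree P T \<and>
        (\<forall>w'. (\<forall>e\<in>Q. w' e = w e) \<and> (\<forall>e\<in>edges P - Q. w' e \<in> uncertainty_interval P e)
           \<longrightarrow> is_MST P w' T))"

definition OPT :: "('v, 'e) uncertain_graph \<Rightarrow> ('e \<Rightarrow> real) \<Rightarrow> 'e set" where
  "OPT P w = (ARG_MIN card Q. feasible P w Q)"

text \<open>For a trivial interval the middle region is empty and the outer ones share the point
  \<open>lower P e' = upper P e'\<close>, so the region containing a number need not be unique.\<close>

definition hop :: "('v, 'e) uncertain_graph \<Rightarrow> ('e \<Rightarrow> real) \<Rightarrow> 'e \<Rightarrow> 'e \<Rightarrow> nat" where
  "hop P w e' e =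
     (if \<exists>R\<in>{{..lower P e'}, {lower P e'<..<upper P e'}, {upper P e'..}}.
           w e \<in> R \<and> prediction P e \<in> R
      then 0 else 1)"

definition hop_distance :: "('v, 'e) uncertain_graph \<Rightarrow> ('e \<Rightarrow> real) \<Rightarrow> nat" where
  "hop_distance P w = (\<Sum>e\<in>edges P. \<Sum>e'\<in>edges P - {e}. hop P w e' e)"

definition prediction_mandatory :: "('v, 'e) uncertain_graph \<Rightarrow> 'e \<Rightarrow> bool" where
  "prediction_mandatory P e \<longleftrightarrow>
     e \<in> edges P \<and> (\<forall>Q. feasible P (prediction P) Q \<longrightarrow> e \<in> Q)"

definition prediction_mandatory_free :: "('v, 'e) uncertain_graph \<Rightarrow> bool" where
  "prediction_mandatory_free P \<longleftrightarrow> \<not> (\<exists>e. prediction_mandatory P e)"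

definition edge_disjoint_pmf_instances ::
  "(('v, 'e) uncertain_graph \<times> ('e \<Rightarrow> real)) set" where
  "edge_disjoint_pmf_instances =
     {(P, w) \<in> mst_instances. edge_disjoint_cycles P \<and> prediction_mandatory_free P}"

text \<open>A deterministic algorithm maps the initial information and the list of queried edges
  with their revealed weights to the next query, or to \<open>None\<close> if it stops.\<close>

type_synonym ('v, 'e) query_algorithm =
  "('v, 'e) uncertain_graph \<Rightarrow> ('e \<times> real) list \<Rightarrow> 'e option"

primrec history ::
  "('v, 'e) query_algorithm \<Rightarrow> ('v, 'e) uncertain_graph \<Rightarrow> ('e \<Rightarrow> real) \<Rightarrow> nat \<Rightarrow> ('e \<times> real) list"
where
  "history A P w 0 = []"
| "history A P w (Suc t) =
     (case A P (history A P w t) of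
        None \<Rightarrow> history A P w t
      | Some e \<Rightarrow> history A P w t @ [(e, w e)])"

definition ALG ::
  "('v, 'e) query_algorithm \<Rightarrow> ('v, 'e) uncertain_graph \<Rightarrow> ('e \<Rightarrow> real) \<Rightarrow> 'e set" where
  "ALG A P w = (\<Union>t. fst ` set (history A P w t))"

text \<open>An algorithm may stop as soon as its query set is feasible, but may also go on.\<close>

definition solves ::
  "('v, 'e) query_algorithm \<Rightarrow> (('v, 'e) uncertain_graph \<times> ('e \<Rightarrow> real)) set \<Rightarrow> bool" where
  "solves A \<I> \<longleftrightarrow>
     (\<forall>(P, w)\<in>\<I>. (\<exists>t. A P (history A P w t) = None) \<and> feasible P w (ALG A P w))"

text \<open>The competitive ratio as a function of the hop distance \<open>k\<close> and the optimum \<open>n\<close>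
  (meaningful for \<open>n > 0\<close>): the worst-case ratio over all instances with these parameters, that is,
  the least \<open>\<rho>\<close> with \<open>card ALG \<le> \<rho> * card OPT\<close> on all of them. It is \<open>- \<infinity>\<close> if there is
  no such instance.\<close>

definition competitive_ratio ::
  "('v, 'e) query_algorithm \<Rightarrow> (('v, 'e) uncertain_graph \<times> ('e \<Rightarrow> real)) set
     \<Rightarrow> nat \<Rightarrow> nat \<Rightarrow> ereal" where
  "competitive_ratio A \<I> k n =
     (SUP (P, w) \<in> {(P, w) \<in> \<I>. hop_distance P w = k \<and> card (OPT P w) = n}.
        ereal (real (card (ALG A P w)) / real (card (OPT P w))))"

end

theory Submission
  imports Defs
begin

text \<open>On two parallel edges whose intervals overlap, with the predictions outside the overlap,
  each edge on its own suffices if the predictions are right. The adversary moves the weight of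
  whichever edge is queried first into the overlap, which makes the other query necessary and
  sufficient: one misprediction costs one additional query. The response to an adaptive algorithm
  is one fixed weight function among the finitely many choices \<open>s\<close> of the mispredicted edges:
  flipping \<open>s i\<close> when double edge \<open>i\<close> is queried for the first time does not change the
  history so far.\<close>

section \<open>Stars of double edges\<close>

locale double_star =
  fixes G :: "('v, 'e, 'z) multigraph_scheme" and n :: nat
    and v :: "nat \<Rightarrow> 'v" and ed :: "nat \<Rightarrow> bool \<Rightarrow> 'e"
  assumes inj_v: "inj v"
    and ed_eq_iff [simp]: "ed i b = ed j c \<longleftrightarrow> i = j \<and> b = c"
    and verts_G: "verts G = v ` {..n}"
    and edges_G: "edges G = {ed i b | i b. i < n}"
    and ends_ed: "ends G (ed i b) = {v 0, v (Suc i)}"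
begin

lemma v_eq_iff [simp]: "v i = v j \<longleftrightarrow> i = j"
  using inj_v by (auto dest: injD)

lemma edges_G_image: "edges G = (\<lambda>(i, b). ed i b) ` ({..<n} \<times> UNIV)"
  by (auto simp: edges_G)

lemma finite_edges: "finite (edges G)"
  by (simp add: edges_G_image)

lemma ed_in_edges [simp]: "ed i b \<in> edges G \<longleftrightarrow> i < n"
  by (auto simp: edges_G)

lemma multigraph_G: "multigraph G"
  using finite_edges by (auto simp: multigraph_def verts_G ends_ed edges_G)

section \<open>Cycles, spanning trees and minimum spanning trees of the star\<close>

lemma is_cycle_pair:
  assumes "i < n"
  shows "is_cycle G {ed i False, ed i True}"
  unfolding is_cycle_def
proof (intro exI conjI)
  show "\<forall>j<length [v 0, v (Suc i)]. ends G ([ed i False, ed i True] ! j) =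
      {[v 0, v (Suc i)] ! j, [v 0, v (Suc i)] ! (Suc j mod length [v 0, v (Suc i)])}"
    by (auto simp: less_Suc_eq ends_ed)
qed (use assms in \<open>auto simp: verts_G\<close>)

lemma is_cycle_iff: "is_cycle G C \<longleftrightarrow> (\<exists>i<n. C = {ed i False, ed i True})"
proof
  assume "is_cycle G C"
  then obtain vs es where len: "length es = length vs" "2 \<le> length vs"
    and dist: "distinct vs" "distinct es" and es: "set es \<subseteq> edges G"
    and ends: "\<And>j. j < length vs \<Longrightarrow> ends G (es ! j) = {vs ! j, vs ! (Suc j mod length vs)}"
    and C: "C = set es"
    unfolding is_cycle_def by blast
  have edge: "\<exists>i b. i < n \<and> es ! j = ed i b" if "j < length vs" for j
  proof -
    have "es ! j \<in> edges G"
      using es that len(1) by (auto dest: nth_mem)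
    then show ?thesis by (auto simp: edges_G)
  qed
  have centre: "v 0 = vs ! j \<or> v 0 = vs ! (Suc j mod length vs)" if j: "j < length vs" for j
  proof -
    obtain i b where "es ! j = ed i b"
      using edge[OF j] by blast
    then have "v 0 \<in> ends G (es ! j)"
      by (simp add: ends_ed)
    then show ?thesis
      unfolding ends[OF j] by simp
  qed
  \<comment> \<open>The centre occurs only once on the cycle, but is an end of all of its edges.\<close>
  have "length vs = 2"
  proof (rule ccontr)
    assume "length vs \<noteq> 2"
    with len have "3 \<le> length vs" by simp
    then obtain x y z zs where vs: "vs = x # y # z # zs"
      by (auto simp: Suc_le_length_iff numeral_3_eq_3)
    have "v 0 = x \<or> v 0 = y" "v 0 = y \<or> v 0 = z"
      using centre[of 0] centre[of 1] by (simp_all add: vs)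
    then have "v 0 = y"
      using dist(1) by (auto simp: vs)
    moreover have "v 0 \<noteq> y"
      using centre[of 2] dist(1) by (cases zs) (auto simp: vs)
    ultimately show False by contradiction
  qed
  then obtain x y where vs: "vs = [x, y]"
    by (auto simp: numeral_2_eq_2 length_Suc_conv)
  from len(1) vs obtain a b where eab: "es = [a, b]"
    by (auto simp: length_Suc_conv)
  obtain i p where a: "i < n" "a = ed i p"
    using edge[of 0] by (auto simp: vs eab)
  obtain j q where b: "j < n" "b = ed j q"
    using edge[of 1] by (auto simp: vs eab)
  have "{v 0, v (Suc i)} = {x, y}" "{v 0, v (Suc j)} = {y, x}"
    using ends[of 0] ends[of 1] by (auto simp: vs eab a b ends_ed)
  then have "i = j"
    by (auto simp: doubleton_eq_iff)
  moreover have "p \<noteq> q"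
    using dist(2) \<open>i = j\<close> by (auto simp: eab a b)
  ultimately show "\<exists>i<n. C = {ed i False, ed i True}"
    using a b by (intro exI[of _ i]) (cases p; auto simp: C eab)
qed (auto intro: is_cycle_pair)

lemma edge_disjoint_cycles_G: "edge_disjoint_cycles G"
  unfolding edge_disjoint_cycles_def is_cycle_iff
proof (intro conjI allI impI set_eqI iffI)
  fix x assume "x \<in> edges G"
  then obtain i b where "i < n" "x = ed i b" by (auto simp: edges_G)
  then show "x \<in> \<Union> {C. \<exists>i<n. C = {ed i False, ed i True}}"
    by (intro UnionI[of "{ed i False, ed i True}"]) auto
qed auto

lemma connects_iff:
  assumes "F \<subseteq> edges G"
  shows "connects G F \<longleftrightarrow> (\<forall>i<n. \<exists>b. ed i b \<in> F)"
proof
  let ?R = "{(x, y). \<exists>e\<in>F. ends G e = {x, y}}"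
  show "\<forall>i<n. \<exists>b. ed i b \<in> F" if con: "connects G F"
  proof (intro allI impI)
    fix i assume i: "i < n"
    have "(v (Suc i), v 0) \<in> ?R\<^sup>*"
      using con i by (auto simp: connects_def verts_G)
    then obtain y where "(v (Suc i), y) \<in> ?R"
      by (rule converse_rtranclE) auto
    then obtain e where e: "e \<in> F" "ends G e = {v (Suc i), y}" by blast
    then obtain j b where "e = ed j b" using assms by (auto simp: edges_G)
    then show "\<exists>b. ed i b \<in> F"
      using e by (auto simp: ends_ed doubleton_eq_iff)
  qed
  show "connects G F" if all: "\<forall>i<n. \<exists>b. ed i b \<in> F"
  proof -
    have *: "(v 0, v i) \<in> ?R\<^sup>* \<and> (v i, v 0) \<in> ?R\<^sup>*" if "i \<le> n" for i
    proof (cases i)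
      case (Suc j)
      then have "j < n" using that by simp
      then obtain b where "ed j b \<in> F" using all by blast
      then have "(v 0, v i) \<in> ?R" "(v i, v 0) \<in> ?R"
        using Suc ends_ed[of j b] by (auto simp: insert_commute)
      then show ?thesis by blast
    qed auto
    show ?thesis
      unfolding connects_def verts_G using * by (blast intro: rtrancl_trans)
  qed
qed

lemma connects_G: "connects G (edges G)"
  by (subst connects_iff) auto

text \<open>Connectivity forces at least one edge of each pair, acyclicity at most one, so a tree
  amounts to a choice function \<open>c\<close>.\<close>

lemma spanning_tree_iff:
  "spanning_tree G T \<longleftrightarrow> (\<exists>c. T = (\<lambda>i. ed i (c i)) ` {..<n})"
proof
  assume T: "spanning_tree G T"
  then have sub: "T \<subseteq> edges G" and "\<forall>i<n. \<exists>b. ed i b \<in> T"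
    by (auto simp: spanning_tree_def connects_iff)
  then obtain c where c: "\<And>i. i < n \<Longrightarrow> ed i (c i) \<in> T" by metis
  have unique: "b = c i" if "i < n" "ed i b \<in> T" for i b
  proof (rule ccontr)
    assume "b \<noteq> c i"
    then have "{ed i False, ed i True} \<subseteq> T"
      using c[OF that(1)] that(2) by (cases b) auto
    then show False
      using T is_cycle_pair[OF that(1)] by (auto simp: spanning_tree_def)
  qed
  have "T = (\<lambda>i. ed i (c i)) ` {..<n}"
  proof (intro equalityI subsetI)
    fix e assume "e \<in> T"
    moreover from this obtain i b where "i < n" "e = ed i b"
      using sub by (auto simp: edges_G)
    ultimately show "e \<in> (\<lambda>i. ed i (c i)) ` {..<n}"
      using unique[of i b] by auto
  qed (use c in auto)
  then show "\<exists>c. T = (\<lambda>i. ed i (c i)) ` {..<n}"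
    by blast
next
  assume "\<exists>c. T = (\<lambda>i. ed i (c i)) ` {..<n}"
  then obtain c where T: "T = (\<lambda>i. ed i (c i)) ` {..<n}" by blast
  then have "T \<subseteq> edges G" by auto
  then show "spanning_tree G T"
    unfolding spanning_tree_def is_cycle_iff
    by (subst connects_iff) (auto simp: T)
qed

text \<open>The pairs are chosen independently, so the weight of a tree is minimised pair by
  pair.\<close>

lemma is_MST_iff:
  "is_MST G w ((\<lambda>i. ed i (c i)) ` {..<n}) \<longleftrightarrow> (\<forall>i<n. w (ed i (c i)) \<le> w (ed i (\<not> c i)))"
proof -
  have sum: "sum w ((\<lambda>i. ed i (c i)) ` {..<n}) = (\<Sum>i<n. w (ed i (c i)))" for c
    by (subst sum.reindex) (auto simp: inj_on_def)
  have "is_MST G w ((\<lambda>i. ed i (c i)) ` {..<n}) \<longleftrightarrow>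
      (\<forall>d. (\<Sum>i<n. w (ed i (c i))) \<le> (\<Sum>i<n. w (ed i (d i))))"
    unfolding is_MST_def spanning_tree_iff by (auto simp: sum[symmetric])
  also have "\<dots> \<longleftrightarrow> (\<forall>i<n. w (ed i (c i)) \<le> w (ed i (\<not> c i)))"
  proof (intro iffI allI impI)
    fix i assume "\<forall>d. (\<Sum>i<n. w (ed i (c i))) \<le> (\<Sum>i<n. w (ed i (d i)))" and i: "i < n"
    \<comment> \<open>Compare with the tree that differs only in pair \<open>i\<close>; all other
      summands cancel.\<close>
    then have "(\<Sum>j<n. w (ed j (c j))) \<le> (\<Sum>j<n. w (ed j ((c(i := \<not> c i)) j)))"
      by blast
    also have "(\<Sum>j\<in>{..<n} - {i}. w (ed j ((c(i := \<not> c i)) j))) =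
        (\<Sum>j\<in>{..<n} - {i}. w (ed j (c j)))"
      by (intro sum.cong) auto
    then have "(\<Sum>j<n. w (ed j ((c(i := \<not> c i)) j))) =
        w (ed i (\<not> c i)) + (\<Sum>j\<in>{..<n} - {i}. w (ed j (c j)))"
      using i by (simp add: sum.remove[of _ i])
    finally show "w (ed i (c i)) \<le> w (ed i (\<not> c i))"
      using i by (simp add: sum.remove[of _ i])
  next
    fix d assume *: "\<forall>i<n. w (ed i (c i)) \<le> w (ed i (\<not> c i))"
    have "w (ed i (c i)) \<le> w (ed i (d i))" if "i < n" for i
      using * that by (cases "d i = c i") auto
    then show "(\<Sum>i<n. w (ed i (c i))) \<le> (\<Sum>i<n. w (ed i (d i)))"
      by (intro sum_mono) auto
  qed
  finally show ?thesis .
qed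

end

text \<open>Reduces feasibility to one comparison per pair. It stands outside the locale because
  intervals exist only for uncertain graphs, not for a general multigraph scheme.\<close>

lemma feasible_double_star_iff:
  fixes ed :: "nat \<Rightarrow> bool \<Rightarrow> 'e"
  assumes "double_star P n v ed"
  shows "feasible P w Q \<longleftrightarrow> Q \<subseteq> edges P \<and>
    (\<exists>c. \<forall>w'. (\<forall>e\<in>Q. w' e = w e) \<and> (\<forall>e\<in>edges P - Q. w' e \<in> uncertainty_interval P e) \<longrightarrow>
       (\<forall>i<n. w' (ed i (c i)) \<le> w' (ed i (\<not> c i))))"
proof -
  interpret double_star P n v ed by fact
  have "(\<exists>T. (\<exists>c. T = f c) \<and> \<Phi> T) \<longleftrightarrow> (\<exists>c. \<Phi> (f c))"
    for f :: "(nat \<Rightarrow> bool) \<Rightarrow> 'e set" and \<Phi>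
    by blast
  then show ?thesis
    unfolding feasible_def spanning_tree_iff by (simp add: is_MST_iff)
qed

section \<open>Query histories\<close>

text \<open>A deterministic algorithm sees only revealed weights. This lets the adversary change the
  weight of an edge not queried so far.\<close>

lemma history_cong:
  assumes "\<And>e. e \<in> fst ` set (history A P w t) \<Longrightarrow> w' e = w e"
  shows "history A P w' t = history A P w t"
  using assms by (induction t) (auto split: option.splits)

lemma history_stop:
  assumes "A P (history A P w t) = None" and "t \<le> t'"
  shows "history A P w t' = history A P w t"
  using assms(2) by (induction t' rule: dec_induct) (use assms(1) in auto)

lemma set_history_mono: "t \<le> t' \<Longrightarrow> set (history A P w t) \<subseteq> set (history A P w t')"
  by (induction t' rule: dec_induct) (auto split: option.splits)

lemma ALG_stop:
  assumes "A P (history A P w t) = None"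
  shows "ALG A P w = fst ` set (history A P w t)"
proof -
  have "set (history A P w t') \<subseteq> set (history A P w t)" for t'
    using set_history_mono[of t' t A P w] history_stop[of A P w t t'] assms
    by (cases "t' \<le> t") auto
  then show ?thesis unfolding ALG_def by blast
qed

section \<open>The adversary\<close>

text \<open>The \<open>i\<close>-th double edge, \<open>i < opt\<close>, has the intervals \<open>(0, 6)\<close> and \<open>(2, 8)\<close> and the
  predictions \<open>1\<close> and \<open>7\<close>, all shifted by \<open>10 * i\<close>. For \<open>i < min k opt\<close> the edge \<open>ed i (s i)\<close> is
  mispredicted: its weight is \<open>5\<close> or \<open>3\<close>, inside the interval of the other one. The remaining
  \<open>k - opt\<close> double edges are trivial and only serve to increase the hop distance: their
  weight \<open>4\<close> separates the weight of the mispredicted edge with \<open>i = 0\<close> from its prediction.\<close>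

locale adversary =
  fixes v :: "nat \<Rightarrow> 'v" and ed :: "nat \<Rightarrow> bool \<Rightarrow> 'e" and k opt :: nat
  assumes inj_v: "inj v"
    and inj_ed: "ed i b = ed j c \<longleftrightarrow> i = j \<and> b = c"
    and opt_pos: "1 \<le> opt"
begin

text \<open>The record fields are functions on all of \<open>'e\<close>, so the numbering
  \<open>ed\<close> has to be inverted; values outside its range are unspecified.\<close>

definition index :: "'e \<Rightarrow> nat \<times> bool" where
  "index = inv (\<lambda>(i, b). ed i b)"

text \<open>The value 0 lies below all weights and predictions of the other pairs, so only the value
  4 can add to the hop distance.\<close>

definition triv :: "bool \<Rightarrow> real" where
  "triv b = (if b then 0 else 4)"

definition pred :: "nat \<Rightarrow> bool \<Rightarrow> real" where
  "pred i b = (if i < opt then 10 * real i + (if b then 7 else 1) else triv b)"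

text \<open>Truncated subtraction: there are no trivial pairs when \<open>k\<close> is at most
  \<open>opt\<close>.\<close>

definition n :: nat where
  "n = opt + (k - opt)"

text \<open>The shift 10 exceeds the span 8 of a nontrivial pair, so a misprediction inside one such
  pair crosses no interval end of another.\<close>

definition P :: "('v, 'e) uncertain_graph" where
  "P = \<lparr>verts = v ` {..n}, edges = {ed i b | i b. i < n},
     ends = (\<lambda>e. {v 0, v (Suc (fst (index e)))}),
     lower = (\<lambda>e. case index e of (i, b) \<Rightarrow>
       if i < opt then 10 * real i + (if b then 2 else 0) else triv b),
     upper = (\<lambda>e. case index e of (i, b) \<Rightarrow>
       if i < opt then 10 * real i + (if b then 8 else 6) else triv b),
     prediction = (\<lambda>e. case index e of (i, b) \<Rightarrow> pred i b)\<rparr>"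

text \<open>The test \<open>e = ed i (s i)\<close>, rather than \<open>b = s i\<close>, makes the value independent of \<open>s\<close> outside
  the range of \<open>ed\<close>: an algorithm may query any element of the edge type.\<close>

definition weight :: "(nat \<Rightarrow> bool) \<Rightarrow> 'e \<Rightarrow> real" where
  "weight s e = (case index e of (i, b) \<Rightarrow>
     if i < min k opt \<and> e = ed i (s i) then 10 * real i + (if b then 3 else 5) else pred i b)"

lemma index_ed [simp]: "index (ed i b) = (i, b)"
proof -
  have "inj (\<lambda>(i, b). ed i b)"
    by (auto simp: inj_def inj_ed)
  from inv_f_f[OF this, of "(i, b)"] show ?thesis
    by (simp add: index_def)
qed

lemma double_star_P: "double_star P n v ed"
  by unfold_locales (auto simp: P_def inj_v inj_ed)

sublocale double_star P n v ed
  by (rule double_star_P)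

lemma lower_ed [simp]:
    "lower P (ed i b) = (if i < opt then 10 * real i + (if b then 2 else 0) else triv b)"
  and upper_ed [simp]:
    "upper P (ed i b) = (if i < opt then 10 * real i + (if b then 8 else 6) else triv b)"
  and prediction_ed [simp]: "prediction P (ed i b) = pred i b"
  and weight_ed: "weight s (ed i b) =
    (if i < min k opt \<and> b = s i then 10 * real i + (if b then 3 else 5) else pred i b)"
  by (simp_all add: P_def weight_def)

lemma weight_in_interval: "weight s (ed i b) \<in> uncertainty_interval P (ed i b)"
  by (auto simp: uncertainty_interval_def weight_ed pred_def)

lemma prediction_in_interval: "prediction P (ed i b) \<in> uncertainty_interval P (ed i b)"
  by (auto simp: uncertainty_interval_def pred_def)

lemma mst_instance: "(P, weight s) \<in> mst_instances"
  unfolding mst_instances_def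
  using multigraph_G connects_G weight_in_interval prediction_in_interval
  by (auto simp: edges_G triv_def)

section \<open>Feasible query sets and the size of the optimum\<close>

lemma feasible_correct_edges:
  assumes w: "\<And>i. i < opt \<Longrightarrow> w (ed i (\<not> s i)) = pred i (\<not> s i)"
  shows "feasible P w ((\<lambda>i. ed i (\<not> s i)) ` {..<opt})"
  unfolding feasible_double_star_iff[OF double_star_P]
\<comment> \<open>The tree takes the \<open>False\<close> edge of a nontrivial pair and the
  \<open>True\<close> edge, of weight 0, of a trivial one. A correct prediction lies outside the
  other interval: 1 below (2, 8), 7 above (0, 6). So one query settles the pair.\<close>
proof (intro conjI exI[of _ "\<lambda>i. opt \<le> i"] allI impI)
  fix w' i
  assume w': "(\<forall>e\<in>(\<lambda>i. ed i (\<not> s i)) ` {..<opt}. w' e = w e) \<and>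
      (\<forall>e\<in>edges P - (\<lambda>i. ed i (\<not> s i)) ` {..<opt}. w' e \<in> uncertainty_interval P e)"
    and i: "i < n"
  show "w' (ed i (opt \<le> i)) \<le> w' (ed i (\<not> opt \<le> i))"
  proof (cases "i < opt")
    case True
    have "w' (ed i (\<not> s i)) = pred i (\<not> s i)"
      using w' w True by auto
    moreover have "w' (ed i (s i)) \<in> uncertainty_interval P (ed i (s i))"
      using w' i by auto
    ultimately show ?thesis
      using True by (cases "s i") (auto simp: pred_def uncertainty_interval_def)
  next
    case False
    have "w' (ed i b) \<in> uncertainty_interval P (ed i b)" for b
      using w' False i by auto
    from this[of True] this[of False] show ?thesis
      using False by (auto simp: uncertainty_interval_def triv_def)
  qed
qed (auto simp: n_def)

lemma feasible_weight: "feasible P (weight s) ((\<lambda>i. ed i (\<not> s i)) ` {..<opt})"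
  by (rule feasible_correct_edges) (simp add: weight_ed)

text \<open>Localises feasibility to pair \<open>i\<close>: one choice \<open>d\<close> must be
  right for all values \<open>x\<close> that the queries leave possible there. The other edges keep
  their true weights, which are admissible.\<close>

lemma feasible_order:
  assumes "feasible P w Q" and "i < n" and "\<And>e. e \<in> edges P \<Longrightarrow> w e \<in> uncertainty_interval P e"
  obtains d where "\<And>x. (\<And>b. if ed i b \<in> Q then x b = w (ed i b)
      else x b \<in> uncertainty_interval P (ed i b)) \<Longrightarrow> x d \<le> x (\<not> d)"
proof -
  obtain c where c: "\<And>w'. (\<forall>e\<in>Q. w' e = w e) \<and>
      (\<forall>e\<in>edges P - Q. w' e \<in> uncertainty_interval P e) \<Longrightarrow> w' (ed i (c i)) \<le> w' (ed i (\<not> c i))"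
    using assms(1,2) unfolding feasible_double_star_iff[OF double_star_P] by blast
  show ?thesis
  proof (rule that[of "c i"])
    fix x
    assume x: "\<And>b. if ed i b \<in> Q then x b = w (ed i b)
      else x b \<in> uncertainty_interval P (ed i b)"
    define w' where "w' = w(ed i False := x False, ed i True := x True)"
    have w'_ed: "w' (ed i b) = x b" for b
      by (cases b) (auto simp: w'_def)
    have "w' e = (if \<exists>b. e = ed i b then x (snd (index e)) else w e)" for e
      by (auto simp: w'_def)
    then have "(\<forall>e\<in>Q. w' e = w e) \<and> (\<forall>e\<in>edges P - Q. w' e \<in> uncertainty_interval P e)"
      using assms(3) x by (auto split: if_splits)
    from c[OF this] show "x (c i) \<le> x (\<not> c i)"
      by (simp add: w'_ed)
  qed
qed

text \<open>Without the correctly predicted edge, both a query of a mispredicted edge alone and no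
  query at all leave the order of the pair open.\<close>

lemma feasible_weight_imp:
  assumes "feasible P (weight s) Q" and "i < opt" and "ed i (\<not> s i) \<notin> Q"
  shows "\<not> i < min k opt \<and> ed i (s i) \<in> Q"
proof (rule ccontr)
  assume neg: "\<not> ?thesis"
  have "i < n"
    using assms(2) by (simp add: n_def)
  have "weight s e \<in> uncertainty_interval P e" if "e \<in> edges P" for e
    using that weight_in_interval by (auto simp: edges_G)
  with feasible_order[OF assms(1) \<open>i < n\<close>]
  obtain d where d: "\<And>x. (\<And>b. if ed i b \<in> Q then x b = weight s (ed i b)
      else x b \<in> uncertainty_interval P (ed i b)) \<Longrightarrow> x d \<le> x (\<not> d)"
    by blast
  \<comment> \<open>\<open>p\<close> is the value of the \<open>True\<close> edge and
    \<open>q\<close> that of the \<open>False\<close> edge, up to the shift.\<close>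
  define x where "x p q b = 10 * real i + (if b then p else q)" for p q :: real and b
  have bnd: "x p q d \<le> x p q (\<not> d)" if "2 < p" "p < 8" "0 < q" "q < 6"
    "ed i (s i) \<in> Q \<Longrightarrow> if s i then p = 3 else q = 5" for p q
  proof (rule d)
    fix b
    show "if ed i b \<in> Q then x p q b = weight s (ed i b)
      else x p q b \<in> uncertainty_interval P (ed i b)"
      using that neg assms(2,3)
      by (cases "b = s i"; cases "s i") (auto simp: x_def weight_ed uncertainty_interval_def)
  qed
  show False
  proof (cases "s i")
    case True
    \<comment> \<open>The edge \<open>ed i (s i)\<close> keeps its mispredicted value, 3 here and 5
      in the other case; the free partner takes a value on either side of it.\<close>
    from bnd[of 3 1] bnd[of 3 5] True show False by (cases d) (auto simp: x_def)
  next
    case False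
    from bnd[of 3 5] bnd[of 7 5] False show False by (cases d) (auto simp: x_def)
  qed
qed

lemma card_feasible_ge:
  assumes "feasible P (weight s) Q"
  shows "opt \<le> card Q"
proof -
  have "finite Q"
    using assms finite_edges by (auto simp: feasible_def intro: finite_subset)
  have "\<exists>b. ed i b \<in> Q" if "i < opt" for i
    using feasible_weight_imp[OF assms that] by blast
  then have "{..<opt} \<subseteq> (\<lambda>e. fst (index e)) ` Q"
    by (force simp: image_iff)
  from surj_card_le[OF \<open>finite Q\<close> this] show ?thesis by simp
qed

lemma card_OPT: "card (OPT P (weight s)) = opt"
proof -
  let ?Q = "(\<lambda>i. ed i (\<not> s i)) ` {..<opt}"
  have "card ?Q = opt"
    by (subst card_image) (auto simp: inj_on_def)
  moreover have "feasible P (weight s) (OPT P (weight s))"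
    "card (OPT P (weight s)) \<le> card ?Q"
    unfolding OPT_def
    using arg_min_nat_lemma[of "feasible P (weight s)", OF feasible_weight, of card]
      feasible_weight[of s] by blast+
  ultimately show ?thesis
    using card_feasible_ge by (metis le_antisym)
qed

section \<open>The hop distance of the instance\<close>

lemma hop_weight:
  assumes "i < n" "j < n" "(j, c) \<noteq> (i, b)"
  shows "hop P (weight s) (ed j c) (ed i b) =
    of_bool (i < min k opt \<and> b = s i \<and> (j = i \<and> c \<noteq> b \<or> i = 0 \<and> opt \<le> j \<and> \<not> c))"
proof (cases "i < min k opt \<and> b = s i")
  case False
  then have "weight s (ed i b) = pred i b"
    by (auto simp: weight_ed)
  then show ?thesis
    using False by (auto simp: hop_def)
next
  case True
  consider "j = i" | "j < i" | "i < j" "j < opt" | "opt \<le> j" by linarith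
  then show ?thesis
  proof cases
    \<comment> \<open>An end of the partner's interval separates prediction and weight: 2 lies
      between 1 and 5, or 6 between 3 and 7.\<close>
    case 1
    then have "c \<longleftrightarrow> \<not> s i"
      using True assms(3) by auto
    then show ?thesis
      using 1 True by (cases "s i") (simp_all add: hop_def weight_ed pred_def)
  next
    case 2
    then have "real j + 1 \<le> real i" by linarith
    with 2 True show ?thesis by (auto simp: hop_def weight_ed pred_def)
  next
    case 3
    then have "real i + 1 \<le> real j" by linarith
    with 3 True show ?thesis by (auto simp: hop_def weight_ed pred_def)
  next
    case 4
    show ?thesis
    proof (cases "i = 0")
      case True
      with 4 \<open>i < min k opt \<and> b = s i\<close> show ?thesis
        by (cases "s i"; cases c) (simp_all add: hop_def weight_ed pred_def triv_def)
    next
      case False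
      \<comment> \<open>Beyond pair 0 the shift lifts both weight and prediction above the trivial
        values.\<close>
      then have "1 \<le> real i" by simp
      then have "4 \<le> weight s (ed i b)" "4 \<le> pred i b"
        using True by (auto simp: weight_ed pred_def)
      moreover have "upper P (ed j c) \<le> 4"
        using 4 by (simp add: triv_def)
      ultimately have "weight s (ed i b) \<in> {upper P (ed j c)..} \<and>
          prediction P (ed i b) \<in> {upper P (ed j c)..}"
        unfolding atLeast_iff prediction_ed by linarith
      then have "hop P (weight s) (ed j c) (ed i b) = 0"
        unfolding hop_def by (intro if_P bexI) blast+
      moreover have "j \<noteq> i"
        using 4 True by auto
      ultimately show ?thesis
        using False by simp
    qed
  qed
qed

lemma hop_distance_weight: "hop_distance P (weight s) = k"
proof -
  let ?I = "{..<n} \<times> (UNIV :: bool set)"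
  let ?e = "\<lambda>(i, b). ed i b"
  have inj: "inj_on ?e A" for A
    by (auto simp: inj_on_def)
  have row: "(\<Sum>e'\<in>edges P - {ed i b}. hop P (weight s) e' (ed i b)) =
      (if i < min k opt \<and> b = s i then 1 + (if i = 0 then k - opt else 0) else 0)" if "i < n" for i b
  proof -
    have "edges P - {ed i b} = ?e ` (?I - {(i, b)})"
      by (auto simp: edges_G)
    then have "(\<Sum>e'\<in>edges P - {ed i b}. hop P (weight s) e' (ed i b)) =
        (\<Sum>(j, c)\<in>?I - {(i, b)}. hop P (weight s) (ed j c) (ed i b))"
      by (simp only: sum.reindex[OF inj] o_def) (simp add: case_prod_unfold)
    also have "\<dots> = (\<Sum>(j, c)\<in>?I - {(i, b)}. of_bool (i < min k opt \<and> b = s i \<and>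
        (j = i \<and> c \<noteq> b \<or> i = 0 \<and> opt \<le> j \<and> \<not> c)))"
      unfolding case_prod_unfold
      by (rule sum.cong[OF refl], rule hop_weight) (use that in auto)
    also have "\<dots> = card {(j, c) \<in> ?I - {(i, b)}. i < min k opt \<and> b = s i \<and>
        (j = i \<and> c \<noteq> b \<or> i = 0 \<and> opt \<le> j \<and> \<not> c)}"
      by (simp only: case_prod_unfold) (simp add: sum_of_bool_eq Int_def del: Diff_iff)
    also have "{(j, c) \<in> ?I - {(i, b)}. i < min k opt \<and> b = s i \<and>
        (j = i \<and> c \<noteq> b \<or> i = 0 \<and> opt \<le> j \<and> \<not> c)} =
        (if i < min k opt \<and> b = s i
         then insert (i, \<not> b) (if i = 0 then {opt..<n} \<times> {False} else {}) else {})"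
      using that by auto
    also have "card \<dots> =
        (if i < min k opt \<and> b = s i then 1 + (if i = 0 then k - opt else 0) else 0)"
      using opt_pos by (auto simp: n_def card_cartesian_product)
    finally show ?thesis .
  qed
  have "hop_distance P (weight s) = (\<Sum>(i, b)\<in>?I. if i < min k opt \<and> b = s i
      then 1 + (if i = 0 then k - opt else 0) else 0)"
    unfolding hop_distance_def edges_G_image
    by (subst sum.reindex[OF inj]) (auto simp: row[unfolded edges_G_image] intro!: sum.cong)
  also have "\<dots> = (\<Sum>i<n. if i < min k opt then 1 + (if i = 0 then k - opt else 0) else 0)"
    by (subst sum.cartesian_product[symmetric]) (auto simp: UNIV_bool intro!: sum.cong)
  also have "\<dots> = (\<Sum>i<min k opt. 1 + (if i = 0 then k - opt else 0))"
    by (rule sum.mono_neutral_cong_right) (auto simp: n_def)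
  \<comment> \<open>This is \<open>min k opt + (k - opt)\<close>; since \<open>opt\<close> is
    positive, pair 0 is among the mispredicted ones whenever \<open>k - opt\<close> is
    nonzero.\<close>
  also have "\<dots> = k"
    using opt_pos by (auto simp: sum_Suc)
  finally show ?thesis .
qed

text \<open>Under correct predictions the \<open>True\<close> edges and the \<open>False\<close>
  edges of the nontrivial pairs form two disjoint feasible sets.\<close>

lemma prediction_mandatory_free_P: "prediction_mandatory_free P"
  unfolding prediction_mandatory_free_def
proof
  assume "\<exists>e. prediction_mandatory P e"
  then obtain e where e: "\<And>Q. feasible P (prediction P) Q \<Longrightarrow> e \<in> Q"
    unfolding prediction_mandatory_def by blast
  have "e \<in> (\<lambda>i. ed i (\<not> b)) ` {..<opt}" for b
    using e feasible_correct_edges[of "prediction P" "\<lambda>_. b"] by simp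
  from this[of True] this[of False] show False by auto
qed

lemma pmf_instance: "(P, weight s) \<in> edge_disjoint_pmf_instances"
  by (simp add: edge_disjoint_pmf_instances_def mst_instance edge_disjoint_cycles_G
      prediction_mandatory_free_P)

text \<open>Up to time \<open>t\<close>, every touched pair below \<open>min k opt\<close> has had
  its mispredicted edge queried. Fixing \<open>s\<close> to be false from \<open>min k opt\<close>
  on leaves finitely many candidates.\<close>

lemma history_mispredicted:
  "\<exists>s. (\<forall>i\<ge>min k opt. \<not> s i) \<and>
    (\<forall>i<min k opt. \<forall>b. ed i b \<in> fst ` set (history A P (weight s) t) \<longrightarrow>
       ed i (s i) \<in> fst ` set (history A P (weight s) t))"
proof (induction t)
  case 0
  show ?case by (auto intro: exI[of _ "\<lambda>_. False"])
next
  case (Suc t)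
  then obtain s where s: "\<forall>i\<ge>min k opt. \<not> s i"
    and inv: "\<And>i b. i < min k opt \<Longrightarrow> ed i b \<in> fst ` set (history A P (weight s) t) \<Longrightarrow>
       ed i (s i) \<in> fst ` set (history A P (weight s) t)"
    by blast
  let ?h = "history A P (weight s) t"
  show ?case
  proof (cases "\<exists>i b. A P ?h = Some (ed i b) \<and> i < min k opt \<and> (\<forall>c. ed i c \<notin> fst ` set ?h)")
    case True
    then obtain i b where q: "A P ?h = Some (ed i b)" "i < min k opt"
      and new: "\<And>c. ed i c \<notin> fst ` set ?h" by blast
    \<comment> \<open>The first query into pair \<open>i\<close> is declared mispredicted. Only
      weights of that still untouched pair change, so the history up to \<open>t\<close>
      survives.\<close>
    let ?s = "s(i := b)"
    have "weight ?s e = weight s e" if "e \<in> fst ` set ?h" for e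
    proof -
      have "e \<noteq> ed i c" for c
        using new that by blast
      then show ?thesis
        by (simp add: weight_def split: prod.split)
    qed
    then have h: "history A P (weight ?s) t = ?h"
      by (rule history_cong)
    show ?thesis
    proof (intro exI[of _ ?s] conjI allI impI)
      fix j c assume "j < min k opt"
        and "ed j c \<in> fst ` set (history A P (weight ?s) (Suc t))"
      then show "ed j (?s j) \<in> fst ` set (history A P (weight ?s) (Suc t))"
        using inv[of j c] q(1) by (auto simp: h)
    qed (use s q(2) in auto)
  next
    case False
    show ?thesis
    proof (intro exI[of _ s] conjI allI impI)
      fix j c assume j: "j < min k opt" "ed j c \<in> fst ` set (history A P (weight s) (Suc t))"
      then have "ed j c \<in> fst ` set ?h \<or> A P ?h = Some (ed j c)"
        by (auto split: option.splits)
      then obtain d where "ed j d \<in> fst ` set ?h"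
        using False j(1) by blast
      from inv[OF j(1) this] show "ed j (s j) \<in> fst ` set (history A P (weight s) (Suc t))"
        using set_history_mono[of t "Suc t" A P "weight s"]
        by (meson image_mono in_mono lessI less_imp_le)
    qed (use s in auto)
  qed
qed

text \<open>The bad \<open>s\<close> depends on the time and the stopping time on \<open>s\<close>.
  Finiteness of \<open>S\<close> breaks the circle with one time \<open>T\<close> at which all runs
  have stopped.\<close>

lemma exists_bad_weight:
  assumes "\<And>s. \<exists>t. A P (history A P (weight s) t) = None"
    and feas: "\<And>s. feasible P (weight s) (ALG A P (weight s))"
  shows "\<exists>s. opt + min k opt \<le> card (ALG A P (weight s))"
proof -
  define S where "S = {s. \<forall>i\<ge>min k opt. \<not> s i}"
  have "S \<subseteq> (\<lambda>X i. i \<in> X) ` Pow {..<min k opt}"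
  proof
    fix s assume "s \<in> S"
    then have "s = (\<lambda>i. i \<in> {i. s i})" "{i. s i} \<in> Pow {..<min k opt}"
      by (auto simp: S_def not_le[symmetric])
    then show "s \<in> (\<lambda>X i. i \<in> X) ` Pow {..<min k opt}"
      by (rule image_eqI)
  qed
  then have "finite S"
    by (rule finite_subset) simp
  obtain stop where stop: "\<And>s. A P (history A P (weight s) (stop s)) = None"
    using assms(1) by metis
  define T where "T = Max (stop ` S)"
  have ALG: "ALG A P (weight s) = fst ` set (history A P (weight s) T)" if "s \<in> S" for s
  proof -
    have "stop s \<le> T"
      using \<open>finite S\<close> that by (simp add: T_def)
    then have "history A P (weight s) T = history A P (weight s) (stop s)"
      by (rule history_stop[of A P, OF stop])
    then show ?thesis
      using ALG_stop[of A P, OF stop[of s]] by (simp only:)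
  qed
  obtain s where "s \<in> S" and s: "\<forall>i<min k opt. \<forall>b.
      ed i b \<in> fst ` set (history A P (weight s) T) \<longrightarrow>
      ed i (s i) \<in> fst ` set (history A P (weight s) T)"
    using history_mispredicted[of A T] by (auto simp: S_def)
  let ?Q = "ALG A P (weight s)"
  have some: "\<exists>b. ed i b \<in> ?Q" if "i < opt" for i
    using feasible_weight_imp[OF feas that] by blast
  \<comment> \<open>Feasibility forces the correctly predicted edge, and the adversary's invariant
    then yields the mispredicted one.\<close>
  have both: "ed i b \<in> ?Q" if "i < min k opt" for i b
  proof -
    have "ed i (\<not> s i) \<in> ?Q"
      using feasible_weight_imp[OF feas, of i s] that by auto
    moreover from this have "ed i (s i) \<in> ?Q"
      using s that ALG[OF \<open>s \<in> S\<close>] by blast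
    ultimately show ?thesis
      by (cases "b = s i") auto
  qed
  obtain g where g: "\<And>i. i < opt \<Longrightarrow> ed i (g i) \<in> ?Q"
    using some by metis
  let ?B = "(\<lambda>i. ed i (g i)) ` {..<opt} \<union> (\<lambda>i. ed i (\<not> g i)) ` {..<min k opt}"
  have "card ?B = card ((\<lambda>i. ed i (g i)) ` {..<opt}) + card ((\<lambda>i. ed i (\<not> g i)) ` {..<min k opt})"
    by (rule card_Un_disjoint) auto
  also have "\<dots> = opt + min k opt"
    by (simp add: card_image inj_on_def)
  finally have "opt + min k opt = card ?B" ..
  also have "\<dots> \<le> card ?Q"
  proof (rule card_mono)
    show "finite ?Q"
      using feas[of s] finite_edges by (auto simp: feasible_def intro: finite_subset)
    show "?B \<subseteq> ?Q"
      using g both by auto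
  qed
  finally show ?thesis by blast
qed

end

theorem theorem5p1:
  fixes A :: "('v, 'e) query_algorithm"
    and \<I> :: "(('v, 'e) uncertain_graph \<times> ('e \<Rightarrow> real)) set"
    and k_h opt :: nat
  assumes "infinite (UNIV :: 'v set)" and "infinite (UNIV :: 'e set)"
    and "\<I> \<in> {mst_instances, edge_disjoint_pmf_instances}"
    and "solves A \<I>"
    and "1 \<le> opt"
  shows "competitive_ratio A \<I> k_h opt \<ge> ereal (min (1 + real k_h / real opt) 2)"
proof -
  obtain v :: "nat \<Rightarrow> 'v" where "inj v"
    using infinite_countable_subset[OF assms(1)] by blast
  obtain f :: "nat \<Rightarrow> 'e" where "inj f"
    using infinite_countable_subset[OF assms(2)] by blast
  \<comment> \<open>Even and odd indices keep the two edges of all pairs distinct.\<close>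
  define ed where "ed i b = f (2 * i + of_bool b)" for i b
  interpret adversary v ed k_h opt
  proof
    show "ed i b = ed j c \<longleftrightarrow> i = j \<and> b = c" for i j b c
      unfolding ed_def inj_eq[OF \<open>inj f\<close>] by (cases b; cases c; simp; presburger)
  qed (fact \<open>inj v\<close> \<open>1 \<le> opt\<close>)+
  have inst: "(P, weight s) \<in> \<I>" for s
    using assms(3) mst_instance pmf_instance by auto
  have "\<exists>t. A P (history A P (weight s) t) = None"
    "feasible P (weight s) (ALG A P (weight s))" for s
    using assms(4) inst[of s] unfolding solves_def by blast+
  from exists_bad_weight[of A, OF this]
  obtain s where s: "opt + min k_h opt \<le> card (ALG A P (weight s))"
    by blast
  \<comment> \<open>The two arguments of the minimum are \<open>opt + k_h\<close> and
    \<open>opt + opt\<close>, each divided by \<open>opt\<close>.\<close>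
  have "min (1 + real k_h / real opt) 2 = real (opt + min k_h opt) / real opt"
    using assms(5) by (auto simp: min_def field_simps)
  also have "\<dots> \<le> real (card (ALG A P (weight s))) / real opt"
    using s by (intro divide_right_mono) (simp_all only: of_nat_le_iff of_nat_0_le_iff)
  finally have "ereal (min (1 + real k_h / real opt) 2) \<le>
      ereal (real (card (ALG A P (weight s))) / real (card (OPT P (weight s))))"
    unfolding card_OPT ereal_less_eq .
  also have "\<dots> \<le> competitive_ratio A \<I> k_h opt"
    unfolding competitive_ratio_def
    by (rule SUP_upper2[of "(P, weight s)"]) (use inst in \<open>auto simp: hop_distance_weight card_OPT\<close>)
  finally show ?thesis .
qed

end
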